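(* Let $p\in L$ be a proper element, $b\in L$, and let $n\geqslant 2$ be an integer. Suppose $b$ is $k$-potent $\delta$-primary to $p$ for some integer $k$ with $2\leqslant k\leqslant n$. Then $b$ is $\phi$-$\delta$-primary to $p$ for some function $\phi:L\to L$ with $\phi\leqslant\phi_n$ if and only if $b$ is $\delta$-primary to $p$.
   Context: A multiplicative lattice is a complete lattice (least element $0$, largest element $1$) with a commutative, associative multiplication that distributes over arbitrary joins and has $1$ as multiplicative identity. An element $a$ is compact if whenever $a\leqslant \vee X$ for $X\subseteq L$ there are finitely many $a_1,\dots,a_n\in X$ with $a\leqslant a_1\vee\cdots\vee a_n$. Standing assumptions: $L$ is a compactly generated multiplicative lattice (every element is a join of compact elements), $1$ is compact, and every finite product of compact elements is compact. An element $p$ is proper if $p<1$. $\delta:L\to L$ is an expansion function: $a\leqslant\delta(a)$ for all $a$, and $a\leqslant b$ implies $\delta(a)\leqslant\delta(b)$. An element $b$ is $\delta$-primary to a proper element $p$ if for all $x\in L$, $xb\leqslant p$ implies $x\leqslant\delta(p)$. For an integer $k\geqslant 2$, $b$ is $k$-potent $\delta$-primary to a proper element $p$ if for all $x\in L$, $xb\leqslant p^k$ implies $x\leqslant\delta(p)$. For $\phi:L\to L$, $b$ is $\phi$-$\delta$-primary to a proper element $p$ if for all $x\in L$, $xb\leqslant p$ and $xb\not\leqslant\phi(p)$ implies $x\leqslant\delta(p)$. $\phi_n(q)=q^n$ for $n\geqslant 2$. For functions $\gamma_1,\gamma_2:L\to L$, $\gamma_1\leqslant\gamma_2$ means $\gamma_1(a)\leqslant\gamma_2(a)$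 for every $a\in L$. *)

theory Defs
  imports Main
begin

text \<open>
  The least element of a multiplicative lattice is \<^term>\<open>bot\<close>; its largest element
  is identified with the multiplicative identity \<^term>\<open>1\<close> by \<open>one_eq_top\<close>.
  The empty join is included in the distributive law, so \<open>a * bot = bot\<close>.
\<close>

class multiplicative_lattice = complete_lattice + comm_monoid_mult +
  assumes one_eq_top: "1 = top"
    and mult_Sup: "a * Sup X = Sup ((\<lambda>x. a * x) ` X)"

text \<open>The finite subfamily may be empty; in particular \<^term>\<open>bot\<close> is compact.\<close>

definition (in complete_lattice) compact_element :: "'a \<Rightarrow> bool" where
  "compact_element a \<longleftrightarrow>
     (\<forall>X. a \<le> Sup X \<longrightarrow> (\<exists>F. finite F \<and> F \<subseteq> X \<and> a \<le> Sup F))"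

class cg_multiplicative_lattice = multiplicative_lattice +
  assumes compactly_generated: "\<exists>X. (\<forall>x\<in>X. compact_element x) \<and> a = Sup X"
    and compact_one: "compact_element 1"
    and compact_prod: "(\<forall>c\<in>set cs. compact_element c) \<Longrightarrow> compact_element (prod_list cs)"

definition expansion_function :: "('a::multiplicative_lattice \<Rightarrow> 'a) \<Rightarrow> bool" where
  "expansion_function \<delta> \<longleftrightarrow>
     (\<forall>a. a \<le> \<delta> a) \<and> (\<forall>a b. a \<le> b \<longrightarrow> \<delta> a \<le> \<delta> b)"

definition proper_element :: "'a::multiplicative_lattice \<Rightarrow> bool" where
  "proper_element p \<longleftrightarrow> p < 1"

definition delta_primary_to ::
    "('a::multiplicative_lattice \<Rightarrow> 'a) \<Rightarrow> 'a \<Rightarrow> 'a \<Rightarrow> bool" where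
  "delta_primary_to \<delta> b p \<longleftrightarrow>
     proper_element p \<and> (\<forall>x. x * b \<le> p \<longrightarrow> x \<le> \<delta> p)"

definition potent_delta_primary_to ::
    "nat \<Rightarrow> ('a::multiplicative_lattice \<Rightarrow> 'a) \<Rightarrow> 'a \<Rightarrow> 'a \<Rightarrow> bool" where
  "potent_delta_primary_to k \<delta> b p \<longleftrightarrow>
     2 \<le> k \<and> proper_element p \<and> (\<forall>x. x * b \<le> p ^ k \<longrightarrow> x \<le> \<delta> p)"

definition phi_delta_primary_to ::
    "('a::multiplicative_lattice \<Rightarrow> 'a) \<Rightarrow> ('a \<Rightarrow> 'a) \<Rightarrow> 'a \<Rightarrow> 'a \<Rightarrow> bool" where
  "phi_delta_primary_to \<phi> \<delta> b p \<longleftrightarrow>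
     proper_element p \<and> (\<forall>x. x * b \<le> p \<and> \<not> x * b \<le> \<phi> p \<longrightarrow> x \<le> \<delta> p)"

definition phi_power :: "nat \<Rightarrow> 'a::multiplicative_lattice \<Rightarrow> 'a" where
  "phi_power n q = q ^ n"

end

theory Submission
  imports Defs
begin

text \<open>Given \<open>x * b \<le> p\<close>, the \<open>\<phi>\<close> condition yields
  \<open>x \<le> \<delta> p\<close> except when \<open>x * b \<le> \<phi> p\<close>. That gap is
  closed by potency: \<open>\<phi> p \<le> p ^ n \<le> p ^ k\<close> by
  \<open>power_antimono_exponent\<close>, so \<open>x * b \<le> p ^ k\<close>. The converse only
  adds a premise.\<close>

lemma mult_left_mono_lattice:
  fixes a b c :: "'a::multiplicative_lattice"
  assumes "b \<le> c"
  shows "a * b \<le> a * c"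
proof -
  \<comment> \<open>Monotonicity comes from distributivity: \<open>c\<close> is the join of
    \<open>b\<close> and \<open>c\<close>, so \<open>a * c\<close> is a join with
    \<open>a * b\<close> as a member.\<close>
  have "a * c = a * Sup {b, c}"
    using assms by (simp add: sup_absorb2)
  also have "\<dots> = Sup {a * b, a * c}"
    by (simp add: mult_Sup del: Sup_insert)
  finally show ?thesis
    by (simp add: le_iff_sup)
qed

text \<open>Powers descend because the extra factor \<open>p ^ (n - k)\<close> lies below
  \<open>1\<close>, the top element.\<close>

lemma power_antimono_exponent:
  fixes p :: "'a::multiplicative_lattice"
  assumes "k \<le> n"
  shows "p ^ n \<le> p ^ k"
proof -
  have "p ^ k * p ^ (n - k) \<le> p ^ k * 1"
    by (rule mult_left_mono_lattice) (simp add: one_eq_top)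
  then show ?thesis
    using assms by (simp flip: power_add)
qed

theorem theorem2p25:
  fixes \<delta> :: "'a::cg_multiplicative_lattice \<Rightarrow> 'a"
    and p b :: 'a
    and n :: nat
  assumes "expansion_function \<delta>"
    and "proper_element p"
    and "2 \<le> n"
    and "\<exists>k. 2 \<le> k \<and> k \<le> n \<and> potent_delta_primary_to k \<delta> b p"
  shows "(\<exists>\<phi> :: 'a \<Rightarrow> 'a. \<phi> \<le> phi_power n \<and> phi_delta_primary_to \<phi> \<delta> b p)
           \<longleftrightarrow> delta_primary_to \<delta> b p"
proof
  assume "\<exists>\<phi> :: 'a \<Rightarrow> 'a. \<phi> \<le> phi_power n \<and> phi_delta_primary_to \<phi> \<delta> b p"
  then obtain \<phi> :: "'a \<Rightarrow> 'a" where le: "\<phi> \<le> phi_power n"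
    and phi: "phi_delta_primary_to \<phi> \<delta> b p"
    by blast
  obtain k where "k \<le> n" and potent: "potent_delta_primary_to k \<delta> b p"
    using assms(4) by blast
  have "\<phi> p \<le> p ^ n"
    using le by (simp add: le_fun_def phi_power_def)
  also have "\<dots> \<le> p ^ k"
    using \<open>k \<le> n\<close> by (rule power_antimono_exponent)
  finally have "\<phi> p \<le> p ^ k" .
  \<comment> \<open>Case split on \<open>x * b \<le> \<phi> p\<close>: if it holds, potency applies
    by transitivity; otherwise the \<open>\<phi>\<close> condition does.\<close>
  then have "x \<le> \<delta> p" if "x * b \<le> p" for x
    using that phi potent order_trans
    unfolding phi_delta_primary_to_def potent_delta_primary_to_def by blast
  then show "delta_primary_to \<delta> b p"
    using assms(2) by (simp add: delta_primary_to_def)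
next
  assume "delta_primary_to \<delta> b p"
  \<comment> \<open>The largest admissible \<open>\<phi>\<close> serves as witness.\<close>
  then have "phi_delta_primary_to (phi_power n) \<delta> b p"
    by (simp add: delta_primary_to_def phi_delta_primary_to_def)
  then show "\<exists>\<phi> :: 'a \<Rightarrow> 'a. \<phi> \<le> phi_power n \<and> phi_delta_primary_to \<phi> \<delta> b p"
    by blast
qed

end
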